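(* Let $a>0$ be an integer, let $RM_a^{(1)} = \sum_{i\geq 0} (-1)^i m_{(a+i)}\, e_{i}^\perp$, and define $$RM_a = \sum_{k \geq 0} (-1)^k \frac{\left( RM_a^{(1)} \right)^{k+1} }{(k+1)!} \left(h_a^k\right)^\perp .$$ Then $RM_a\, m_\lambda = m_{\lambda+(a)}$ for every partition $\lambda$.
   Context: $m_\lambda$, $e_i$, $h_a$ are the monomial, elementary, and complete homogeneous symmetric functions ($e_0=1$), with $m_{(a+i)}$ acting by multiplication; $g^\perp$ denotes the adjoint of multiplication by $g$ with respect to the Hall inner product, and $(h_a^k)^\perp$ is the adjoint of multiplication by the $k$-th power $h_a^k$. $\lambda+(a)$ is the partition obtained by inserting a part equal to $a$ into $\lambda$. *)

theory Defs
  imports Complex_Main "HOL-Library.Multiset" "HOL-Library.Groups_Big_Fun"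
begin

section \<open>The ring of symmetric functions\<close>

text \<open>
  A monomial in the variables \<open>x\<^sub>0, x\<^sub>1, x\<^sub>2, \<dots>\<close> is encoded by the multiset of the indices of its
  variables, so that \<open>{#0,0,2#}\<close> stands for \<open>x\<^sub>0\<^sup>2 x\<^sub>2\<close>; union of multisets is the product of
  monomials and \<open>size\<close> is the degree. A partition is the multiset of its (positive) parts.
\<close>

type_synonym monomial = "nat multiset"
type_synonym "partition" = "nat multiset"

definition is_partition :: "partition \<Rightarrow> bool" where
  "is_partition lam \<longleftrightarrow> 0 \<notin># lam"

definition exponents :: "monomial \<Rightarrow> partition" where
  "exponents A = image_mset (count A) (mset_set (set_mset A))"

text \<open>
  A symmetric function is a formal power series of bounded degree (given by its coefficients)
  that is invariant under all permutations of the variables.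
\<close>

typedef (overloaded) 'a symfun =
  "{f :: monomial \<Rightarrow> 'a::zero.
      (\<forall>p A. bij p \<longrightarrow> f (image_mset p A) = f A) \<and> (\<exists>d. \<forall>A. size A > d \<longrightarrow> f A = 0)}"
  morphisms sf_coeff Abs_symfun
  by (rule exI[of _ "\<lambda>_. 0"]) auto

setup_lifting type_definition_symfun

lemma symfun_eqI: "(\<And>A. sf_coeff f A = sf_coeff g A) \<Longrightarrow> f = g"
  by (simp add: sf_coeff_inject[symmetric] fun_eq_iff)

lemma finite_submsets: "finite {B. B \<subseteq># (A :: 'b multiset)}"
proof (rule finite_subset)
  show "{B. B \<subseteq># A} \<subseteq> mset ` {xs. set xs \<subseteq> set_mset A \<and> length xs \<le> size A}"
  proof
    fix B assume "B \<in> {B. B \<subseteq># A}"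
    then have B: "B \<subseteq># A" by simp
    obtain xs where xs: "mset xs = B" using ex_mset by blast
    have "set xs \<subseteq> set_mset A" using set_mset_mono[OF B] xs by auto
    moreover have "length xs \<le> size A" using size_mset_mono[OF B] xs by auto
    ultimately show "B \<in> mset ` {xs. set xs \<subseteq> set_mset A \<and> length xs \<le> size A}"
      using xs by blast
  qed
  show "finite (mset ` {xs. set xs \<subseteq> set_mset A \<and> length xs \<le> size A})"
    by (intro finite_imageI finite_lists_length_le) simp
qed

lemma inj_image_mset: "inj p \<Longrightarrow> inj (image_mset p)"
  by (rule injI) (metis image_mset.compositionality image_mset.id inv_o_cancel id_apply)

lemma submsets_image:
  assumes "inj p"
  shows "{B. B \<subseteq># image_mset p A} = image_mset p ` {B. B \<subseteq># A}"
proof (intro equalityI subsetI)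
  fix B assume "B \<in> {B. B \<subseteq># image_mset p A}"
  then obtain C where "image_mset p A = B + C" by (auto simp: subset_mset.le_iff_add)
  then obtain B' C' where "A = B' + C'" "B = image_mset p B'"
    using image_mset_eq_plusD by metis
  then show "B \<in> image_mset p ` {B. B \<subseteq># A}" by auto
qed (auto intro: image_mset_subseteq_mono)

instantiation symfun :: (comm_ring_1) comm_ring_1
begin

lift_definition zero_symfun :: "'a symfun" is "\<lambda>_. 0" by auto

lift_definition one_symfun :: "'a symfun" is "\<lambda>A. if A = {#} then 1 else 0"
  by (auto intro!: exI[of _ 0])

lift_definition plus_symfun :: "'a symfun \<Rightarrow> 'a symfun \<Rightarrow> 'a symfun" is "\<lambda>f g A. f A + g A"
proof safe
  fix f g :: "monomial \<Rightarrow> 'a" and d d'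
  assume "\<forall>A. d < size A \<longrightarrow> f A = 0" "\<forall>A. d' < size A \<longrightarrow> g A = 0"
  then show "\<exists>d. \<forall>A. d < size A \<longrightarrow> f A + g A = 0"
    by (intro exI[of _ "max d d'"]) auto
qed auto

lift_definition uminus_symfun :: "'a symfun \<Rightarrow> 'a symfun" is "\<lambda>f A. - f A" by auto

lift_definition minus_symfun :: "'a symfun \<Rightarrow> 'a symfun \<Rightarrow> 'a symfun" is "\<lambda>f g A. f A - g A"
proof safe
  fix f g :: "monomial \<Rightarrow> 'a" and d d'
  assume "\<forall>A. d < size A \<longrightarrow> f A = 0" "\<forall>A. d' < size A \<longrightarrow> g A = 0"
  then show "\<exists>d. \<forall>A. d < size A \<longrightarrow> f A - g A = 0"
    by (intro exI[of _ "max d d'"]) auto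
qed auto

lift_definition times_symfun :: "'a symfun \<Rightarrow> 'a symfun \<Rightarrow> 'a symfun"
  is "\<lambda>f g A. \<Sum>B | B \<subseteq># A. f B * g (A - B)"
proof safe
  fix f g :: "monomial \<Rightarrow> 'a" and d d' A and p :: "nat \<Rightarrow> nat"
  assume f: "\<forall>p A. bij p \<longrightarrow> f (image_mset p A) = f A"
    and g: "\<forall>p A. bij p \<longrightarrow> g (image_mset p A) = g A" and p: "bij p"
  have inj: "inj p" using p by (rule bij_is_inj)
  have "(\<Sum>B | B \<subseteq># image_mset p A. f B * g (image_mset p A - B))
      = (\<Sum>B | B \<subseteq># A. f (image_mset p B) * g (image_mset p A - image_mset p B))"
    unfolding submsets_image[OF inj]
    by (subst sum.reindex) (auto intro: inj_on_subset[OF inj_image_mset[OF inj]])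
  also have "\<dots> = (\<Sum>B | B \<subseteq># A. f B * g (A - B))"
    using f g p by (intro sum.cong) (auto simp flip: image_mset_Diff)
  finally show "(\<Sum>B | B \<subseteq># image_mset p A. f B * g (image_mset p A - B))
      = (\<Sum>B | B \<subseteq># A. f B * g (A - B))" .
next
  fix f g :: "monomial \<Rightarrow> 'a" and d d'
  assume f: "\<forall>A. d < size A \<longrightarrow> f A = 0" and g: "\<forall>A. d' < size A \<longrightarrow> g A = 0"
  have "f B * g (A - B) = 0" if "d + d' < size A" "B \<subseteq># A" for A B
  proof (cases "d < size B")
    case False
    then have "d' < size (A - B)" using that by (simp add: size_Diff_submset)
    then show ?thesis using g by simp
  qed (use f in simp)
  then show "\<exists>d. \<forall>A. d < size A \<longrightarrow> (\<Sum>B | B \<subseteq># A. f B * g (A - B)) = 0"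
    by (intro exI[of _ "d + d'"]) (auto intro!: sum.neutral)
qed

instance
proof
  fix a b c :: "'a symfun"
  show "a + b + c = a + (b + c)" by transfer (simp add: add.assoc)
  show "a + b = b + a" by transfer (simp add: add.commute)
  show "0 + a = a" by transfer simp
  show "- a + a = 0" by transfer simp
  show "a - b = a + - b" by transfer simp
  show "a * b = b * a"
  proof (transfer, rule ext)
    fix a b :: "monomial \<Rightarrow> 'a" and A
    show "(\<Sum>B | B \<subseteq># A. a B * b (A - B)) = (\<Sum>B | B \<subseteq># A. b B * a (A - B))"
      by (rule sum.reindex_bij_witness[of _ "\<lambda>B. A - B" "\<lambda>B. A - B"])
         (auto simp: double_diff subset_mset.diff_diff_right mult.commute)
  qed
  show "a * b * c = a * (b * c)"
  proof (transfer, rule ext)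
    fix a b c :: "monomial \<Rightarrow> 'a" and A
    have "(\<Sum>B | B \<subseteq># A. (\<Sum>C | C \<subseteq># B. a C * b (B - C)) * c (A - B))
        = (\<Sum>(B, C) \<in> Sigma {B. B \<subseteq># A} (\<lambda>B. {C. C \<subseteq># B}). a C * b (B - C) * c (A - B))"
      by (simp add: sum_distrib_right sum.Sigma finite_submsets)
    also have "\<dots> = (\<Sum>(C, D) \<in> Sigma {C. C \<subseteq># A} (\<lambda>C. {D. D \<subseteq># A - C}).
        a C * (b D * c (A - C - D)))"
      by (rule sum.reindex_bij_witness[of _ "\<lambda>(C, D). (C + D, C)" "\<lambda>(B, C). (C, B - C)"])
         (auto simp: subset_mset.le_iff_add mult.assoc ac_simps)
    also have "\<dots> = (\<Sum>B | B \<subseteq># A. a B * (\<Sum>C | C \<subseteq># A - B. b C * c (A - B - C)))"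
      by (simp add: sum_distrib_left sum.Sigma finite_submsets)
    finally show "(\<Sum>B | B \<subseteq># A. (\<Sum>C | C \<subseteq># B. a C * b (B - C)) * c (A - B))
        = (\<Sum>B | B \<subseteq># A. a B * (\<Sum>C | C \<subseteq># A - B. b C * c (A - B - C)))" .
  qed
  show "1 * a = a"
  proof (transfer, rule ext)
    fix a :: "monomial \<Rightarrow> 'a" and A
    have "(\<Sum>B | B \<subseteq># A. (if B = {#} then 1 else 0) * a (A - B))
        = (\<Sum>B \<in> {{#}}. (if B = {#} then 1 else 0) * a (A - B))"
      by (rule sum.mono_neutral_right) (auto simp: finite_submsets)
    then show "(\<Sum>B | B \<subseteq># A. (if B = {#} then 1 else 0) * a (A - B)) = a A" by simp
  qed
  show "(a + b) * c = a * c + b * c"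
    by transfer (simp add: distrib_right sum.distrib)
  show "(0 :: 'a symfun) \<noteq> 1"
    by transfer (auto simp: fun_eq_iff)
qed

end

lift_definition sf_scale :: "'a::comm_ring_1 \<Rightarrow> 'a symfun \<Rightarrow> 'a symfun" is "\<lambda>c f A. c * f A"
  by (simp, metis mult_zero_right)

lemma vector_space_sf_scale:
  "vector_space (sf_scale :: 'a::field \<Rightarrow> 'a symfun \<Rightarrow> 'a symfun)"
  by unfold_locales (transfer; simp add: algebra_simps)+

section \<open>Monomial, elementary and complete homogeneous symmetric functions\<close>

lemma exponents_image_mset: "inj p \<Longrightarrow> exponents (image_mset p A) = exponents A"
  unfolding exponents_def
proof -
  assume p: "inj p"
  have "mset_set (p ` set_mset A) = image_mset p (mset_set (set_mset A))"
    by (rule image_mset_mset_set[symmetric]) (rule inj_on_subset[OF p], simp)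
  moreover have "count (image_mset p A) (p x) = count A x" for x
    by (induction A) (use p in \<open>auto simp: inj_eq\<close>)
  ultimately show "image_mset (count (image_mset p A)) (mset_set (set_mset (image_mset p A)))
      = image_mset (count A) (mset_set (set_mset A))"
    by (simp add: multiset.map_comp comp_def)
qed

lemma sum_mset_exponents: "sum_mset (exponents A) = size A"
  by (simp add: exponents_def size_multiset_overloaded_eq sum_unfold_sum_mset)

text \<open>The \<open>r\<close>-th power sum is \<open>m_sym {#r#}\<close> for \<open>r > 0\<close>.\<close>

lift_definition m_sym :: "partition \<Rightarrow> 'a::comm_ring_1 symfun"
  is "\<lambda>lam A. if exponents A = lam then 1 else 0"
proof safe
  fix lam :: "partition"
  show "\<exists>d. \<forall>A. d < size A \<longrightarrow> (if exponents A = lam then 1 else 0 :: 'a) = 0"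
    by (rule exI[of _ "sum_mset lam"]) (auto simp: sum_mset_exponents)
qed (simp add: exponents_image_mset bij_is_inj)

lift_definition e_sym :: "nat \<Rightarrow> 'a::comm_ring_1 symfun"
  is "\<lambda>r A. if size A = r \<and> (\<forall>i. count A i \<le> 1) then 1 else 0"
proof safe
  fix r :: nat and p :: "nat \<Rightarrow> nat" and A
  assume p: "bij p"
  have c: "count (image_mset p A) (p x) = count A x" for x
    by (induction A) (use p in \<open>auto simp: inj_eq bij_is_inj\<close>)
  have "(\<forall>i. count (image_mset p A) i \<le> 1) \<longleftrightarrow> (\<forall>i. count (image_mset p A) (p i) \<le> 1)"
    using p by (metis bij_pointE)
  then show "(if size (image_mset p A) = r \<and> (\<forall>i. count (image_mset p A) i \<le> 1) then 1 else 0 :: 'a)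
      = (if size A = r \<and> (\<forall>i. count A i \<le> 1) then 1 else 0)"
    by (simp add: c)
qed auto

lift_definition h_sym :: "nat \<Rightarrow> 'a::comm_ring_1 symfun"
  is "\<lambda>r A. if size A = r then 1 else 0"
  by auto

section \<open>The Hall inner product and adjoints\<close>

definition bilinear_form :: "('a::field symfun \<Rightarrow> 'a symfun \<Rightarrow> 'a) \<Rightarrow> bool" where
  "bilinear_form B \<longleftrightarrow>
     (\<forall>f. Vector_Spaces.linear sf_scale (*) (\<lambda>g. B f g)) \<and>
     (\<forall>g. Vector_Spaces.linear sf_scale (*) (\<lambda>f. B f g))"

text \<open>
  The families \<open>h\<^sub>\<lambda> = \<Prod>\<^sub>i h\<^sub>\<lambda>\<^sub>i\<close> and \<open>m\<^sub>\<lambda>\<close> are linear bases, so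
  exactly one bilinear form makes them dual to each other; it is symmetric and nondegenerate.
  Multiplication by \<open>g\<close> has exactly one adjoint, which sends \<open>u\<close> to
  \<open>\<Sum>\<^sub>\<lambda> \<langle>u, g h\<^sub>\<lambda>\<rangle> m\<^sub>\<lambda>\<close>.
\<close>

definition hall :: "'a::field symfun \<Rightarrow> 'a symfun \<Rightarrow> 'a" where
  "hall = (THE B. bilinear_form B \<and>
     (\<forall>lam mu. is_partition lam \<longrightarrow> is_partition mu \<longrightarrow>
        B (prod_mset (image_mset h_sym lam)) (m_sym mu) = (if lam = mu then 1 else 0)))"

definition perp :: "'a::field symfun \<Rightarrow> 'a symfun \<Rightarrow> 'a symfun" where
  "perp g = (THE T. \<forall>u v. hall (T u) v = hall u (g * v))"

section \<open>The operators\<close>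

text \<open>
  The infinite sums of operators are pointwise sums. Applied to a function of degree \<open>d\<close>, the
  terms with \<open>i > d\<close> (resp. \<open>a k > d\<close>) vanish, so \<^const>\<open>Sum_any\<close>, which adds
  up the nonzero terms, has finite support here.
\<close>

definition RM1 :: "nat \<Rightarrow> 'a::field symfun \<Rightarrow> 'a symfun" where
  "RM1 a f = Sum_any (\<lambda>i. (-1) ^ i * m_sym {#a + i#} * perp (e_sym i) f)"

definition RM :: "nat \<Rightarrow> 'a::field_char_0 symfun \<Rightarrow> 'a symfun" where
  "RM a f = Sum_any (\<lambda>k. sf_scale ((-1) ^ k / fact (k + 1))
     ((RM1 a ^^ (k + 1)) (perp (h_sym a ^ k) f)))"

end

theory Submission
  imports Defs "HOL-Combinatorics.Permutations"
begin

text \<open>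
  The adjoint of \<open>h\<^sub>n\<close> extracts the coefficient of the \<open>n\<close>-th power of an additional variable,
  and \<open>\<Sum>\<^sub>i (-1)\<^sup>i e\<^sub>i h\<^sub>n\<^sub>-\<^sub>i = 0\<close> for \<open>n > 0\<close>, so \<open>\<Sum>\<^sub>i (-x\<^sub>j)\<^sup>i e\<^sub>i\<^sup>\<bottom> f\<close> is \<open>f\<close> with the variable \<open>x\<^sub>j\<close>
  deleted. Hence \<open>RM1 a f\<close> is the sum over \<open>j\<close> of \<open>x\<^sub>j\<^sup>a\<close> times \<open>f\<close> without \<open>x\<^sub>j\<close>; on \<open>m\<^sub>\<lambda>\<close>, where
  \<open>a\<close> occurs \<open>c\<close> times, it gives \<open>(c + 1) m\<^sub>\<lambda>\<^sub>+\<^sub>(\<^sub>a\<^sub>)\<close>. Since the adjoint of \<open>h\<^sub>a\<^sup>k\<close> removes \<open>k\<close> parts equal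
  to \<open>a\<close>, the \<open>k\<close>-th term of \<open>RM a m\<^sub>\<lambda>\<close> is \<open>(-1)\<^sup>k\<close> times the binomial coefficient of \<open>c + 1\<close> over
  \<open>k + 1\<close>, and these numbers sum to 1.
\<close>

section \<open>Exponents of monomials\<close>

lemma exponents_empty [simp]: "exponents {#} = {#}"
  by (simp add: exponents_def)

lemma exponents_add_replicate:
  assumes "j \<notin># A" "n > 0"
  shows "exponents (A + replicate_mset n j) = add_mset n (exponents A)"
proof -
  have "set_mset (A + replicate_mset n j) = insert j (set_mset A)"
    using assms by auto
  moreover have "image_mset (count (A + replicate_mset n j)) (mset_set (set_mset A)) = exponents A"
    unfolding exponents_def using assms by (intro image_mset_cong) (auto simp: count_eq_zero_iff)
  ultimately show ?thesis
    using assms by (simp add: exponents_def not_in_iff)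
qed

lemma split_off_variable:
  "A = filter_mset (\<lambda>i. i \<noteq> j) A + replicate_mset (count A j) j"
  by (rule multiset_eqI) auto

lemma exponents_filter:
  assumes "j \<in># A"
  shows "exponents A = add_mset (count A j) (exponents (filter_mset (\<lambda>i. i \<noteq> j) A))"
  using exponents_add_replicate[of j "filter_mset (\<lambda>i. i \<noteq> j) A" "count A j"] assms
    split_off_variable[of A j] by simp

lemma is_partition_exponents [simp]: "is_partition (exponents A)"
  by (simp add: is_partition_def exponents_def image_iff)

lemma count_exponents:
  assumes "r > 0"
  shows "count (exponents A) r = card {j \<in> set_mset A. count A j = r}"
  by (simp add: exponents_def count_image_mset' eq_commute[of r])

lemma exponents_surj:
  assumes "is_partition lam"
  obtains A where "exponents A = lam"
  using assms
proof (induction lam arbitrary: thesis)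
  case empty
  then show ?case by (metis exponents_empty)
next
  case (add r lam)
  then obtain A where A: "exponents A = lam" by (auto simp: is_partition_def)
  obtain j where "j \<notin># A" by (meson ex_new_if_finite finite_set_mset infinite_UNIV_nat)
  then have "exponents (A + replicate_mset r j) = add_mset r lam"
    using add.prems A by (intro exponents_add_replicate[THEN trans]) (auto simp: is_partition_def)
  then show ?case by (rule add.prems(1))
qed

lemma exponents_eq_empty_iff [simp]: "exponents A = {#} \<longleftrightarrow> A = {#}"
  by (simp add: exponents_def mset_set_empty_iff)

text \<open>Identifies the monomials of the power sum \<open>m_sym {#r#}\<close>.\<close>

lemma exponents_eq_single_iff:
  assumes "r > 0"
  shows "exponents A = {#r#} \<longleftrightarrow> (\<exists>j. A = replicate_mset r j)"
proof
  assume e: "exponents A = {#r#}"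
  then obtain j where j: "j \<in># A" by fastforce
  have "{#r#} = add_mset (count A j) (exponents (filter_mset (\<lambda>i. i \<noteq> j) A))"
    using exponents_filter[OF j] unfolding e .
  then have "exponents (filter_mset (\<lambda>i. i \<noteq> j) A) = {#}" "count A j = r"
    by (metis add_mset_eq_single)+
  then have "A = {#} + replicate_mset r j"
    using split_off_variable[of A j] unfolding exponents_eq_empty_iff by metis
  then show "\<exists>j. A = replicate_mset r j" by auto
next
  assume "\<exists>j. A = replicate_mset r j"
  then obtain j where "A = {#} + replicate_mset r j" by auto
  then show "exponents A = {#r#}" using exponents_add_replicate[of j "{#}" r] assms by auto
qed

text \<open>Padding by zeros makes the exponents of two monomials comparable over a common index
  set.\<close>

lemma image_mset_count_superset:
  assumes "finite S" "set_mset A \<subseteq> S"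
  shows "image_mset (count A) (mset_set S) = exponents A + replicate_mset (card (S - set_mset A)) 0"
proof -
  have "mset_set S = mset_set (set_mset A) + mset_set (S - set_mset A)"
    using assms by (subst mset_set_Union[symmetric]) (auto simp: Un_absorb1)
  moreover have "image_mset (count A) (mset_set (S - set_mset A))
      = image_mset (\<lambda>_. 0) (mset_set (S - set_mset A))"
    using assms by (intro image_mset_cong) (auto simp: not_in_iff)
  ultimately show ?thesis by (simp add: exponents_def image_mset_const_eq)
qed

text \<open>Over the union of both variable sets the two exponent multisets are padded by equally
  many zeros, so a permutation of that union matches the counts. Hence coefficients of a symmetric
  function depend on \<open>exponents\<close> only.\<close>

lemma exponents_eqE:
  assumes "exponents A = exponents B"
  obtains p where "bij p" "image_mset p A = B"
proof -
  let ?S = "set_mset A \<union> set_mset B"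
  have "card (set_mset A) = card (set_mset B)"
    using arg_cong[OF assms, of size] by (simp add: exponents_def)
  then have "card (?S - set_mset A) = card (?S - set_mset B)"
    by (simp add: card_Diff_subset)
  then have "image_mset (count A) (mset_set ?S) = image_mset (count B) (mset_set ?S)"
    using assms by (simp add: image_mset_count_superset)
  then obtain p where p: "p permutes ?S" and c: "\<forall>x\<in>?S. count A x = count B (p x)"
    using image_mset_eq_implies_permutes[of ?S] by (metis finite_UnI finite_set_mset)
  have bij: "bij p" using p by (rule permutes_bij)
  have c': "count A x = count B (p x)" for x
    using c p by (cases "x \<in> ?S") (auto simp: permutes_not_in not_in_iff)
  have "image_mset p A = B"
  proof (rule multiset_eqI)
    fix y
    obtain x where y: "y = p x" using bij by (metis bij_pointE)
    have "count (image_mset p A) (p x) = count A x"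
      by (induction A) (use bij in \<open>auto simp: inj_eq bij_is_inj\<close>)
    then show "count (image_mset p A) y = count B y" using c' y by simp
  qed
  with bij that show thesis by blast
qed

section \<open>Coefficients\<close>

lemma sf_coeff_image: "bij p \<Longrightarrow> sf_coeff f (image_mset p A) = sf_coeff f A"
  using sf_coeff[of f] by auto

lemma sf_coeff_cong: "exponents A = exponents B \<Longrightarrow> sf_coeff f A = sf_coeff f B"
  by (metis exponents_eqE sf_coeff_image)

lemma sf_coeff_bounded:
  obtains d where "\<And>A. size A > d \<Longrightarrow> sf_coeff f A = 0"
proof -
  have "\<exists>d. \<forall>A. size A > d \<longrightarrow> sf_coeff f A = 0" using sf_coeff[of f] by auto
  then show thesis using that by blast
qed

lemmas sf_coeff_simps [simp] =
  zero_symfun.rep_eq one_symfun.rep_eq plus_symfun.rep_eq uminus_symfun.rep_eq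
  minus_symfun.rep_eq sf_scale.rep_eq m_sym.rep_eq h_sym.rep_eq

lemmas sf_coeff_times = times_symfun.rep_eq

lemma sf_coeff_sum [simp]: "sf_coeff (sum f S) A = (\<Sum>x\<in>S. sf_coeff (f x) A)"
  by (induction S rule: infinite_finite_induct) auto

lemma sf_coeff_of_nat_times [simp]: "sf_coeff (of_nat n * f) A = of_nat n * sf_coeff f A"
  by (induction n) (auto simp: algebra_simps)

lemma sf_coeff_minus_one_power [simp]: "sf_coeff ((- 1) ^ n * f) A = (- 1) ^ n * sf_coeff f A"
  by (induction n) auto

text \<open>A power sum has only the monomials x_j^r, so the sum over all submultisets of
  \<open>A\<close> collapses to these.\<close>

lemma sf_coeff_power_sum_times:
  assumes "r > 0"
  shows "sf_coeff (m_sym {#r#} * g) A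
    = (\<Sum>j | j \<in># A \<and> r \<le> count A j. sf_coeff g (A - replicate_mset r j))"
proof -
  let ?J = "{j. j \<in># A \<and> r \<le> count A j}"
  have inj: "inj_on (replicate_mset r) ?J"
    using assms by (intro inj_onI) (metis count_replicate_mset less_irrefl)
  have "sf_coeff (m_sym {#r#} * g) A
      = (\<Sum>B | B \<subseteq># A. sf_coeff (m_sym {#r#}) B * sf_coeff g (A - B))"
    by (rule fun_cong[OF sf_coeff_times])
  also have "\<dots> = (\<Sum>B\<in>replicate_mset r ` ?J. sf_coeff (m_sym {#r#}) B * sf_coeff g (A - B))"
  proof (rule sum.mono_neutral_right)
    show "finite {B. B \<subseteq># A}" by (rule finite_submsets)
    show "replicate_mset r ` ?J \<subseteq> {B. B \<subseteq># A}"
      by (auto simp: count_le_replicate_mset_subset_eq)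
    show "\<forall>B\<in>{B. B \<subseteq># A} - replicate_mset r ` ?J.
        sf_coeff (m_sym {#r#}) B * sf_coeff g (A - B) = 0"
    proof
      fix B assume B: "B \<in> {B. B \<subseteq># A} - replicate_mset r ` ?J"
      have "exponents B \<noteq> {#r#}"
      proof
        assume "exponents B = {#r#}"
        then obtain j where j: "B = replicate_mset r j"
          using exponents_eq_single_iff[OF assms] by blast
        then have "r \<le> count A j" using B by (auto simp: count_le_replicate_mset_subset_eq)
        then have "j \<in> ?J" using assms by (auto simp flip: count_greater_zero_iff)
        then show False using B j by blast
      qed
      then show "sf_coeff (m_sym {#r#}) B * sf_coeff g (A - B) = 0" by simp
    qed
  qed
  also have "\<dots> = (\<Sum>j\<in>?J. sf_coeff g (A - replicate_mset r j))"
    using assms by (subst sum.reindex[OF inj]) (auto simp: exponents_eq_single_iff intro!: sum.cong)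
  finally show ?thesis .
qed

section \<open>Expansion into monomial symmetric functions\<close>

lemma finite_partitions_le: "finite {lam. is_partition lam \<and> sum_mset lam \<le> d}"
proof (rule finite_subset)
  show "{lam. is_partition lam \<and> sum_mset lam \<le> d}
      \<subseteq> mset ` {xs. set xs \<subseteq> {..d} \<and> length xs \<le> d}"
  proof
    fix lam assume lam: "lam \<in> {lam. is_partition lam \<and> sum_mset lam \<le> d}"
    obtain xs where xs: "mset xs = lam" using ex_mset by blast
    have "size lam \<le> sum_mset lam"
      using lam by (induction lam) (auto simp: is_partition_def)
    moreover have "x \<le> d" if "x \<in># lam" for x
      using lam sum_mset.remove[OF that] by auto
    ultimately show "lam \<in> mset ` {xs. set xs \<subseteq> {..d} \<and> length xs \<le> d}"
      using lam xs by (intro image_eqI[of _ _ xs]) auto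
  qed
  show "finite (mset ` {xs. set xs \<subseteq> {..d} \<and> length xs \<le> d})"
    by (intro finite_imageI finite_lists_length_le) simp
qed

text \<open>Bounded degree makes \<open>f\<close> a finite combination of monomial functions. The
  case \<open>monomial\<close> offers only exponents that occur in \<open>f\<close>;
  \<open>m_sym_in_h_span\<close> relies on this restriction.\<close>

lemma symfun_monomial_induct [case_names monomial add scale zero]:
  assumes m: "\<And>A. sf_coeff f A \<noteq> 0 \<Longrightarrow> P (m_sym (exponents A))"
    and add: "\<And>g h. P g \<Longrightarrow> P h \<Longrightarrow> P (g + h)"
    and scale: "\<And>c g. P g \<Longrightarrow> P (sf_scale c g)"
    and zero: "P 0"
  shows "P f"
proof -
  obtain d where d: "\<And>A. size A > d \<Longrightarrow> sf_coeff f A = 0" by (rule sf_coeff_bounded) blast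
  define L where "L = {exponents A | A. sf_coeff f A \<noteq> 0}"
  \<comment> \<open>A representative monomial for each exponent multiset; the coefficient does not
    depend on the choice.\<close>
  define mono where "mono lam = (SOME A. exponents A = lam)" for lam
  have mono: "exponents (mono (exponents A)) = exponents A" for A
    unfolding mono_def by (rule someI) (rule refl)
  have "sum_mset (exponents A) \<le> d" if "sf_coeff f A \<noteq> 0" for A
    using d[of A] that by (auto simp: sum_mset_exponents not_less[symmetric])
  then have fin: "finite L"
    by (intro finite_subset[OF _ finite_partitions_le[of d]]) (auto simp: L_def)
  have f: "f = (\<Sum>lam\<in>L. sf_scale (sf_coeff f (mono lam)) (m_sym lam))"
  proof (rule symfun_eqI)
    fix A
    have "(\<Sum>lam\<in>L. sf_coeff f (mono lam) * (if exponents A = lam then 1 else 0))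
        = (if exponents A \<in> L then sf_coeff f (mono (exponents A)) else 0)"
      using fin by (simp add: if_distrib cong: if_cong)
    also have "\<dots> = sf_coeff f A"
      using sf_coeff_cong[OF mono, of f A] by (auto simp: L_def)
    finally show "sf_coeff f A
        = sf_coeff (\<Sum>lam\<in>L. sf_scale (sf_coeff f (mono lam)) (m_sym lam)) A" by simp
  qed
  have "P (\<Sum>lam\<in>L'. sf_scale (sf_coeff f (mono lam)) (m_sym lam))" if "L' \<subseteq> L" for L'
    using finite_subset[OF that fin] that
    by (induction L' rule: finite_induct) (auto intro!: zero add scale m simp: L_def)
  from this[of L] show ?thesis using f by simp
qed

section \<open>Products of complete functions span\<close>

definition h_prod :: "partition \<Rightarrow> 'a::comm_ring_1 symfun" where
  "h_prod lam = prod_mset (image_mset h_sym lam)"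

text \<open>The linear span as an inductive set, so that linear statements follow by rule induction
  from the generators; zero and negatives arise by scaling.\<close>

inductive_set h_span :: "'a::comm_ring_1 symfun set" where
  h_prod: "is_partition lam \<Longrightarrow> h_prod lam \<in> h_span"
| add: "f \<in> h_span \<Longrightarrow> g \<in> h_span \<Longrightarrow> f + g \<in> h_span"
| scale: "f \<in> h_span \<Longrightarrow> sf_scale c f \<in> h_span"

lemma sf_scale_times: "sf_scale c f * g = sf_scale c (f * g)"
  by (rule symfun_eqI) (simp add: sf_coeff_times sum_distrib_left mult.assoc)

lemma times_sf_scale: "f * sf_scale c g = sf_scale c (f * g)"
  using sf_scale_times[of c g f] by (simp add: mult.commute)

lemma sf_scale_zero [simp]: "sf_scale 0 f = 0"
  by (rule symfun_eqI) simp

lemma h_sym_0: "h_sym 0 = 1"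
  by (rule symfun_eqI) simp

lemma h_span_zero: "0 \<in> h_span"
  using h_span.scale[OF h_span.h_prod[of "{#}"], of 0] by (simp add: is_partition_def)

lemma h_span_uminus: "f \<in> h_span \<Longrightarrow> - f \<in> h_span"
proof -
  have "- f = sf_scale (-1) f" by (rule symfun_eqI) simp
  then show "f \<in> h_span \<Longrightarrow> - f \<in> h_span" by (simp add: h_span.scale)
qed

lemma h_span_diff: "f \<in> h_span \<Longrightarrow> g \<in> h_span \<Longrightarrow> f - g \<in> h_span"
  using h_span.add[of f "- g"] h_span_uminus[of g] by simp

lemma h_span_sum: "(\<And>x. x \<in> S \<Longrightarrow> f x \<in> h_span) \<Longrightarrow> sum f S \<in> h_span"
  by (induction S rule: infinite_finite_induct) (auto intro: h_span_zero h_span.add)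

lemma h_span_times:
  assumes "f \<in> h_span" "g \<in> h_span"
  shows "f * g \<in> h_span"
  using assms(1)
proof induction
  case (h_prod lam)
  show ?case using assms(2)
  proof induction
    case (h_prod mu)
    have "h_prod lam * h_prod mu = (h_prod (lam + mu) :: 'a symfun)" by (simp add: h_prod_def)
    then show ?case
      using \<open>is_partition lam\<close> h_prod h_span.h_prod[of "lam + mu"] by (simp add: is_partition_def)
  qed (auto simp: distrib_left times_sf_scale intro: h_span.intros)
qed (auto simp: distrib_right sf_scale_times intro: h_span.intros)

lemma h_sym_in_h_span: "h_sym n \<in> h_span"
\<comment> \<open>\<open>{#0#}\<close> is not a partition, so h_0 = 1 has to be obtained as the
  empty product.\<close>
proof (cases "n = 0")
  case True
  then show ?thesis using h_span.h_prod[of "{#}"] by (simp add: h_prod_def is_partition_def h_sym_0)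
next
  case False
  then show ?thesis using h_span.h_prod[of "{#n#}"] by (simp add: h_prod_def is_partition_def)
qed

section \<open>Newton's identities\<close>

lemma size_minus_replicate:
  "i \<le> count A j \<Longrightarrow> size (A - replicate_mset i j) = size A - i"
  by (subst size_Diff_submset) (auto simp: count_le_replicate_mset_subset_eq)

text \<open>At a monomial of degree \<open>n\<close> the right side counts the pairs (i, j) with 1
  \<le> i \<le> \<open>count A j\<close>; every variable contributes its exponent, and the exponents
  add up to \<open>n\<close>.\<close>

lemma newton_h:
  "of_nat n * (h_sym n :: 'a::comm_ring_1 symfun) = (\<Sum>i=1..n. m_sym {#i#} * h_sym (n - i))"
proof (rule symfun_eqI)
  fix A
  show "sf_coeff (of_nat n * (h_sym n :: 'a symfun)) A
      = sf_coeff (\<Sum>i=1..n. m_sym {#i#} * h_sym (n - i)) A"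
  proof (cases "size A = n")
    case True
    have "sf_coeff (\<Sum>i=1..n. m_sym {#i#} * h_sym (n - i) :: 'a symfun) A
        = (\<Sum>i=1..n. \<Sum>j | j \<in># A \<and> i \<le> count A j. 1)"
      unfolding sf_coeff_sum
    proof (intro sum.cong refl)
      fix i assume i: "i \<in> {1..n}"
      have "size (A - replicate_mset i j) = n - i" if "i \<le> count A j" for j
        using size_minus_replicate[OF that] True by simp
      then show "sf_coeff (m_sym {#i#} * h_sym (n - i)) A = (\<Sum>j | j \<in># A \<and> i \<le> count A j. 1)"
        using i by (subst sf_coeff_power_sum_times) auto
    qed
    also have "\<dots> = (\<Sum>i=1..n. \<Sum>j\<in>set_mset A. if i \<le> count A j then 1 else 0)"
      by (intro sum.cong refl sum.inter_filter) simp
    also have "\<dots> = (\<Sum>j\<in>set_mset A. \<Sum>i=1..n. if i \<le> count A j then 1 else 0)"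
      by (rule sum.swap)
    also have "\<dots> = (\<Sum>j\<in>set_mset A. of_nat (count A j))"
    proof (intro sum.cong refl)
      fix j assume "j \<in># A"
      have "count A j \<le> n" using True count_le_size by metis
      then have "{i \<in> {1..n}. i \<le> count A j} = {1..count A j}" by auto
      then show "(\<Sum>i=1..n. if i \<le> count A j then 1 else 0) = of_nat (count A j)"
        by (simp flip: sum.inter_filter)
    qed
    also have "\<dots> = of_nat n"
      using True by (simp add: size_multiset_overloaded_eq flip: of_nat_sum)
    finally show ?thesis using True by simp
  next
    case False
    have "sf_coeff (m_sym {#i#} * h_sym (n - i) :: 'a symfun) A = 0" if i: "i \<in> {1..n}" for i
    proof -
      have "size (A - replicate_mset i j) \<noteq> n - i" if "i \<le> count A j" for j
        using size_minus_replicate[OF that] that False i count_le_size[of A j] by auto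
      then show ?thesis using i by (subst sf_coeff_power_sum_times) auto
    qed
    then show ?thesis using False by simp
  qed
qed

text \<open>In Newton's identity the term i = n is the power sum itself, as h_0 = 1; the other terms
  are covered by induction.\<close>

lemma power_sum_in_h_span: "n > 0 \<Longrightarrow> (m_sym {#n#} :: 'a::comm_ring_1 symfun) \<in> h_span"
proof (induction n rule: less_induct)
  case (less n)
  have "{1..n} = insert n {1..<n}" using less.prems by auto
  then have "(m_sym {#n#} :: 'a symfun) = of_nat n * h_sym n - (\<Sum>i\<in>{1..<n}. m_sym {#i#} * h_sym (n - i))"
    by (simp add: newton_h h_sym_0)
  moreover have "of_nat n * h_sym n = sf_scale (of_nat n) (h_sym n :: 'a symfun)"
    by (rule symfun_eqI) (simp only: sf_coeff_of_nat_times sf_scale.rep_eq)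
  ultimately show ?case
    using less.IH by (auto intro!: h_span_diff h_span_sum h_span_times h_sym_in_h_span h_span.scale)
qed

section \<open>Monomial functions lie in the span\<close>

lemma size_exponents: "size (exponents A) = card (set_mset A)"
  by (simp add: exponents_def)

lemma exponents_minus_replicate_iff:
  assumes "r > 0"  "j \<in># A" "count A j = r"
  shows "exponents (A - replicate_mset r j) = mu \<longleftrightarrow> exponents A = add_mset r mu"
proof -
  have "A - replicate_mset r j = filter_mset (\<lambda>i. i \<noteq> j) A"
    using assms by (intro multiset_eqI) auto
  then show ?thesis using exponents_filter[of j A] assms by simp
qed

text \<open>The summand is the same for all variables of exponent \<open>r\<close>, so the sum
  counts these variables; their number is the multiplicity of \<open>r\<close> in
  \<open>add_mset r mu\<close>.\<close>

lemma sum_exponents_minus_replicate: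
  assumes "r > 0"
  shows "(\<Sum>j | j \<in># A \<and> count A j = r. if exponents (A - replicate_mset r j) = mu then 1 else 0)
    = (if exponents A = add_mset r mu then of_nat (count mu r + 1) else (0::'a::comm_ring_1))"
proof -
  have "(\<Sum>j | j \<in># A \<and> count A j = r. if exponents (A - replicate_mset r j) = mu then 1 else 0)
      = (\<Sum>j | j \<in># A \<and> count A j = r. if exponents A = add_mset r mu then 1 else (0::'a))"
    using assms by (intro sum.cong) (auto simp: exponents_minus_replicate_iff)
  moreover have "card {j. j \<in># A \<and> count A j = r} = count mu r + 1" if "exponents A = add_mset r mu"
    using count_exponents[OF assms, of A] that by simp
  ultimately show ?thesis by simp
qed

text \<open>Induction on the number of parts: a part \<open>r\<close> is split off as a power sum,
  and the result is divided by the multiplicity of \<open>r\<close>, which uses characteristic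
  zero.\<close>

lemma m_sym_in_h_span:
  assumes "is_partition lam"
  shows "(m_sym lam :: 'a::field_char_0 symfun) \<in> h_span"
  using assms
proof (induction "size lam" arbitrary: lam rule: less_induct)
  case less
  show ?case
  proof (cases lam)
    case empty
    have "(m_sym {#} :: 'a symfun) = h_sym 0" by (rule symfun_eqI) simp
    then show ?thesis using empty by (simp add: h_sym_in_h_span)
  next
    case (add r mu)
    have r: "r > 0" and mu: "is_partition mu" using add less.prems by (auto simp: is_partition_def)
    \<comment> \<open>The product of \<open>m_sym mu\<close> with a power sum is a multiple of \<open>m_sym lam\<close> plus functions
      whose monomials involve fewer variables.\<close>
    define g :: "'a symfun" where
      "g = m_sym {#r#} * m_sym mu - of_nat (count mu r + 1) * m_sym lam"
    have coeff_g: "sf_coeff g A = (\<Sum>j | j \<in># A \<and> r < count A j.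
        if exponents (A - replicate_mset r j) = mu then 1 else 0)" for A
    proof -
      \<comment> \<open>Variables of exponent exactly \<open>r\<close> produce the multiple of
        \<open>m_sym lam\<close> that \<open>g\<close> subtracts; larger exponents remain.\<close>
      have "{j. j \<in># A \<and> r \<le> count A j}
          = {j. j \<in># A \<and> count A j = r} \<union> {j. j \<in># A \<and> r < count A j}" by auto
      then have "sf_coeff (m_sym {#r#} * m_sym mu :: 'a symfun) A
          = (\<Sum>j | j \<in># A \<and> count A j = r. if exponents (A - replicate_mset r j) = mu then 1 else 0)
          + (\<Sum>j | j \<in># A \<and> r < count A j. if exponents (A - replicate_mset r j) = mu then 1 else 0)"
        unfolding sf_coeff_power_sum_times[OF r] m_sym.rep_eq
        by (subst sum.union_disjoint[symmetric]) auto
      then show ?thesis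
        unfolding g_def minus_symfun.rep_eq sf_coeff_of_nat_times
        using sum_exponents_minus_replicate[OF r, where 'a='a, of A mu] add by auto
    qed
    have "g \<in> h_span"
    proof (induction g rule: symfun_monomial_induct)
      case (monomial A)
      obtain j where j: "j \<in># A" "r < count A j" "exponents (A - replicate_mset r j) = mu"
      proof (rule ccontr)
        assume "\<not> thesis"
        then have "sf_coeff g A = 0" unfolding coeff_g using that by (intro sum.neutral) auto
        then show False using monomial by simp
      qed
      \<comment> \<open>Since \<open>r < count A j\<close>, the variable \<open>j\<close> survives,
        so \<open>A\<close> has as many variables as \<open>mu\<close> has parts, one fewer than
        \<open>lam\<close>.\<close>
      have "set_mset (A - replicate_mset r j) = set_mset A"
        using j by (intro set_eqI) (auto simp: in_diff_count split: if_splits)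
      then have "size (exponents A) < size lam"
        using j add by (metis lessI size_add_mset size_exponents)
      then show ?case by (rule less.hyps) simp
    qed (auto intro: h_span.intros h_span_zero)
    moreover have "(m_sym {#r#} * m_sym mu :: 'a symfun) \<in> h_span"
      using r mu add less.hyps[of mu] by (intro h_span_times power_sum_in_h_span) auto
    ultimately have "sf_scale (1 / of_nat (count mu r + 1)) (m_sym {#r#} * m_sym mu - g) \<in> h_span"
      by (intro h_span.scale h_span_diff)
    moreover have "sf_scale (1 / of_nat (count mu r + 1)) (m_sym {#r#} * m_sym mu - g) = m_sym lam"
    proof (rule symfun_eqI)
      fix A
      have "of_nat (count mu r + 1) \<noteq> (0::'a)" using of_nat_neq_0[of "count mu r"] by simp
      then show "sf_coeff (sf_scale (1 / of_nat (count mu r + 1)) (m_sym {#r#} * m_sym mu - g)) A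
          = sf_coeff (m_sym lam :: 'a symfun) A"
        unfolding g_def sf_scale.rep_eq minus_symfun.rep_eq sf_coeff_of_nat_times by simp
    qed
    ultimately show ?thesis by simp
  qed
qed

lemma in_h_span: "(f :: 'a::field_char_0 symfun) \<in> h_span"
  by (induction f rule: symfun_monomial_induct)
    (auto intro: m_sym_in_h_span h_span.intros h_span_zero)

lemma symfun_h_induct [case_names h_prod add scale]:
  fixes f :: "'a::field_char_0 symfun"
  assumes "\<And>A. P (h_prod (exponents A))"
    and "\<And>g h. P g \<Longrightarrow> P h \<Longrightarrow> P (g + h)"
    and "\<And>c g. P g \<Longrightarrow> P (sf_scale c g)"
  shows "P f"
  using in_h_span[of f]
proof induction
  case (h_prod lam)
  then show ?case using assms(1) exponents_surj by metis
qed (use assms in auto)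

section \<open>The Hall inner product\<close>

text \<open>
  Nonnegative integer matrices with prescribed row and column sums, as multisets of matrix
  positions; the coefficient of \<open>A\<close> in \<open>h_prod (exponents B)\<close> counts those with margins \<open>A\<close> and \<open>B\<close>.
\<close>

definition contingency :: "monomial \<Rightarrow> monomial \<Rightarrow> (nat \<times> nat) multiset set" where
  "contingency A B = {C. image_mset fst C = A \<and> image_mset snd C = B}"

text \<open>Transposition of matrices; this is the source of the symmetry of the Hall
  product.\<close>

lemma contingency_commute: "card (contingency A B) = card (contingency B A)"
proof (rule bij_betw_same_card)
  show "bij_betw (image_mset prod.swap) (contingency A B) (contingency B A)"
    by (rule bij_betw_byWitness[of _ "image_mset prod.swap"])
      (auto simp: contingency_def multiset.map_comp comp_def)
qed

text \<open>The new column \<open>j\<close> is a multiset \<open>D\<close> of \<open>n\<close> row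
  indices; the other columns form a matrix with row margin \<open>A - D\<close>.\<close>

lemma card_contingency_add_replicate:
  assumes "j \<notin># B"
  shows "card (contingency A (B + replicate_mset n j))
    = (\<Sum>D | D \<subseteq># A \<and> size D = n. card (contingency (A - D) B))"
proof -
  let ?S = "SIGMA D:{D. D \<subseteq># A \<and> size D = n}. contingency (A - D) B"
  let ?F = "\<lambda>(D, C). C + image_mset (\<lambda>x. (x, j)) D"
  let ?G = "\<lambda>C. (image_mset fst (filter_mset (\<lambda>x. snd x = j) C), filter_mset (\<lambda>x. snd x \<noteq> j) C)"
  have fj: "filter_mset (\<lambda>x. snd x = j) C = {#}" "filter_mset (\<lambda>x. snd x \<noteq> j) C = C"
    if "image_mset snd C = B" for C :: "(nat \<times> nat) multiset"
  proof -
    have ne: "snd x \<noteq> j" if "x \<in># C" for x using \<open>image_mset snd C = B\<close> that assms by auto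
    have "filter_mset (\<lambda>x. snd x = j) C = filter_mset (\<lambda>_. False) C"
      by (rule filter_mset_cong[OF refl]) (use ne in blast)
    moreover have "filter_mset (\<lambda>x. snd x \<noteq> j) C = filter_mset (\<lambda>_. True) C"
      by (rule filter_mset_cong[OF refl]) (use ne in blast)
    ultimately show "filter_mset (\<lambda>x. snd x = j) C = {#}" "filter_mset (\<lambda>x. snd x \<noteq> j) C = C" by simp_all
  qed
  have split: "filter_mset (\<lambda>x. snd x = j) C = image_mset (\<lambda>x. (x, j)) (image_mset fst (filter_mset (\<lambda>x. snd x = j) C))"
    for C :: "(nat \<times> nat) multiset"
    by (induction C) auto
  have partition: "C = filter_mset (\<lambda>x. snd x \<noteq> j) C + filter_mset (\<lambda>x. snd x = j) C"
    for C :: "(nat \<times> nat) multiset"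
    by (induction C) auto
  have filter_snd: "image_mset snd (filter_mset (\<lambda>x. snd x \<noteq> j) C) = filter_mset (\<lambda>i. i \<noteq> j) (image_mset snd C)"
    "size (filter_mset (\<lambda>x. snd x = j) C) = count (image_mset snd C) j"
    for C :: "(nat \<times> nat) multiset"
    by (induction C) auto
  have "bij_betw ?F ?S (contingency A (B + replicate_mset n j))"
  proof (rule bij_betw_byWitness[of _ ?G])
    show "\<forall>x\<in>?S. ?G (?F x) = x"
      by (auto simp: contingency_def fj filter_mset_image_mset multiset.map_comp comp_def)
    show "\<forall>C\<in>contingency A (B + replicate_mset n j). ?F (?G C) = C"
      using split partition by (metis (no_types, lifting) case_prod_conv)
    show "?F ` ?S \<subseteq> contingency A (B + replicate_mset n j)"
      by (auto simp: contingency_def multiset.map_comp comp_def image_mset_const_eq)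
    show "?G ` contingency A (B + replicate_mset n j) \<subseteq> ?S"
    proof
      fix x assume "x \<in> ?G ` contingency A (B + replicate_mset n j)"
      then obtain C where C: "image_mset fst C = A" "image_mset snd C = B + replicate_mset n j"
        and x: "x = ?G C" by (auto simp: contingency_def)
      have A: "A = image_mset fst (filter_mset (\<lambda>x. snd x \<noteq> j) C) + image_mset fst (filter_mset (\<lambda>x. snd x = j) C)"
        using C(1) partition[of C] by (metis image_mset_union)
      have "filter_mset (\<lambda>i. i \<noteq> j) (B + replicate_mset n j) = B"
        using assms by (intro multiset_eqI) (auto simp: not_in_iff)
      then have "image_mset snd (filter_mset (\<lambda>x. snd x \<noteq> j) C) = B"
        using filter_snd(1)[of C] C(2) by simp
      moreover have "size (filter_mset (\<lambda>x. snd x = j) C) = n"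
        using filter_snd(2)[of C] C(2) assms by (simp add: not_in_iff)
      ultimately show "x \<in> ?S" unfolding x contingency_def by (subst A, subst A) simp
    qed
  qed
  then have "card (contingency A (B + replicate_mset n j)) = card ?S"
    by (rule bij_betw_same_card[symmetric])
  also have "\<dots> = (\<Sum>D | D \<subseteq># A \<and> size D = n. card (contingency (A - D) B))"
  proof (rule card_SigmaI)
    show "finite {D. D \<subseteq># A \<and> size D = n}"
      by (rule finite_subset[OF _ finite_submsets[of A]]) auto
    show "\<forall>D\<in>{D. D \<subseteq># A \<and> size D = n}. finite (contingency (A - D) B)"
    proof
      fix D
      have "contingency (A - D) B \<subseteq> mset ` {xs. set xs \<subseteq> set_mset (A - D) \<times> set_mset B \<and> length xs \<le> size B}"
      proof
        fix C assume C: "C \<in> contingency (A - D) B"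
        obtain xs where xs: "mset xs = C" using ex_mset by blast
        have "set_mset C \<subseteq> set_mset (A - D) \<times> set_mset B"
        proof
          fix x assume "x \<in># C"
          then have "fst x \<in># image_mset fst C" "snd x \<in># image_mset snd C" by auto
          then show "x \<in> set_mset (A - D) \<times> set_mset B"
            using C by (cases x) (simp only: contingency_def mem_Collect_eq fst_conv snd_conv mem_Sigma_iff)
        qed
        moreover have "size C = size B" using C by (auto simp: contingency_def)
        ultimately show "C \<in> mset ` {xs. set xs \<subseteq> set_mset (A - D) \<times> set_mset B \<and> length xs \<le> size B}"
          using xs by (intro image_eqI[of _ _ xs]) auto
      qed
      then show "finite (contingency (A - D) B)"
        by (rule finite_subset) (intro finite_imageI finite_lists_length_le finite_cartesian_product finite_set_mset)
    qed
  qed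
  finally show ?thesis .
qed

lemma sf_coeff_h_times:
  "sf_coeff (h_sym n * f) A = (\<Sum>D | D \<subseteq># A \<and> size D = n. sf_coeff f (A - D))"
proof -
  have "sf_coeff (h_sym n * f) A
      = (\<Sum>D | D \<subseteq># A. if size D = n then sf_coeff f (A - D) else 0)"
    unfolding sf_coeff_times by (intro sum.cong) auto
  also have "\<dots> = (\<Sum>D | D \<subseteq># A \<and> size D = n. sf_coeff f (A - D))"
    using sum.inter_filter[OF finite_submsets[of A], of "\<lambda>D. sf_coeff f (A - D)" "\<lambda>D. size D = n"] by simp
  finally show ?thesis .
qed

text \<open>A variable enters together with its full power, so that \<open>exponents\<close> grows
  by one part in each step.\<close>

lemma monomial_induct [case_names empty variable]:
  assumes "P {#}" "\<And>B j n. j \<notin># B \<Longrightarrow> n > 0 \<Longrightarrow> P B \<Longrightarrow> P (B + replicate_mset n j)"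
  shows "P (B :: monomial)"
proof (induction "card (set_mset B)" arbitrary: B)
  case 0
  then show ?case using assms(1) by simp
next
  case (Suc k)
  then obtain j where j: "j \<in># B" by fastforce
  let ?B = "filter_mset (\<lambda>i. i \<noteq> j) B"
  have "set_mset ?B = set_mset B - {j}" by auto
  then have "P ?B" using Suc j by (intro Suc.hyps) simp
  then have "P (?B + replicate_mset (count B j) j)" using j by (intro assms(2)) auto
  then show ?case using split_off_variable[of B j] by simp
qed

text \<open>Each factor h_n contributes a new column of sum \<open>n\<close>.\<close>

lemma sf_coeff_h_prod:
  "sf_coeff (h_prod (exponents B) :: 'a::comm_ring_1 symfun) A = of_nat (card (contingency A B))"
proof (induction B arbitrary: A rule: monomial_induct)
  case empty
  have "contingency A {#} = (if A = {#} then {{#}} else {})" by (auto simp: contingency_def)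
  then show ?case by (simp add: h_prod_def)
next
  case (variable B j n)
  have "h_prod (exponents (B + replicate_mset n j)) = (h_sym n * h_prod (exponents B) :: 'a symfun)"
    using variable by (simp add: exponents_add_replicate h_prod_def)
  then show ?case
    using variable by (simp add: sf_coeff_h_times card_contingency_add_replicate)
qed

lemma sf_coeff_h_prod_commute:
  "sf_coeff (h_prod (exponents B)) A = sf_coeff (h_prod (exponents A)) B"
  by (simp add: sf_coeff_h_prod contingency_commute[of A B])

text \<open>
  The graph of the map \<open>f \<mapsto> \<langle>f, -\<rangle>\<close>, generated by its values on products of complete functions.
  Symmetry on the generators makes it single-valued, so linear independence of the \<open>h\<^sub>\<lambda>\<close> is
  not needed.
\<close>

inductive pairing :: "'a::comm_ring_1 symfun \<Rightarrow> ('a symfun \<Rightarrow> 'a) \<Rightarrow> bool" where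
  h_prod: "pairing (h_prod (exponents A)) (\<lambda>g. sf_coeff g A)"
| add: "pairing f \<phi> \<Longrightarrow> pairing g \<psi> \<Longrightarrow> pairing (f + g) (\<lambda>x. \<phi> x + \<psi> x)"
| scale: "pairing f \<phi> \<Longrightarrow> pairing (sf_scale c f) (\<lambda>x. c * \<phi> x)"

lemma pairing_linear:
  assumes "pairing f \<phi>"
  shows "\<phi> (g + h) = \<phi> g + \<phi> h" "\<phi> (sf_scale c g) = c * \<phi> g"
  using assms by (induction) (auto simp: algebra_simps)

text \<open>On generators this is the transposition symmetry \<open>sf_coeff_h_prod_commute\<close>;
  the other cases are linear.\<close>

lemma pairing_commute_h_prod:
  "pairing g \<psi> \<Longrightarrow> sf_coeff g A = \<psi> (h_prod (exponents A))"
  by (induction rule: pairing.induct) (auto simp: sf_coeff_h_prod_commute[of A])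

lemma pairing_commute: "pairing f \<phi> \<Longrightarrow> pairing g \<psi> \<Longrightarrow> \<phi> g = \<psi> f"
  by (induction rule: pairing.induct) (auto simp: pairing_commute_h_prod pairing_linear)

lemma pairing_exists: "\<exists>\<phi>. pairing (f :: 'a::field_char_0 symfun) \<phi>"
  by (induction f rule: symfun_h_induct) (blast intro: pairing.intros)+

text \<open>Both functionals take at \<open>g\<close> the value that a functional paired with
  \<open>g\<close> takes at \<open>f\<close>.\<close>

lemma pairing_unique:
  fixes f :: "'a::field_char_0 symfun"
  assumes "pairing f \<phi>" "pairing f \<psi>"
  shows "\<phi> = \<psi>"
proof
  fix g :: "'a symfun"
  obtain \<chi> where "pairing g \<chi>" using pairing_exists by blast
  then show "\<phi> g = \<psi> g" using assms by (metis pairing_commute)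
qed

lemma symfun_m_induct [case_names monomial add scale]:
  fixes f :: "'a::comm_ring_1 symfun"
  assumes m: "\<And>A. P (m_sym (exponents A))"
    and add: "\<And>g h. P g \<Longrightarrow> P h \<Longrightarrow> P (g + h)"
    and scale: "\<And>c g. P g \<Longrightarrow> P (sf_scale c g)"
  shows "P f"
proof (induction f rule: symfun_monomial_induct)
  case zero
  show "P 0" using scale[OF m, of 0] by simp
qed (use assms in auto)

section \<open>Existence and uniqueness of the Hall form\<close>

lemma bilinear_form_iff:
  "bilinear_form B \<longleftrightarrow>
    (\<forall>f g h. B f (g + h) = B f g + B f h) \<and> (\<forall>f g h. B (f + g) h = B f h + B g h) \<and>
    (\<forall>c f g. B f (sf_scale c g) = c * B f g) \<and> (\<forall>c f g. B (sf_scale c f) g = c * B f g)"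
proof -
  have "vector_space ((*) :: 'a \<Rightarrow> 'a \<Rightarrow> 'a)"
    by unfold_locales (auto simp: algebra_simps)
  then show ?thesis
    unfolding bilinear_form_def Vector_Spaces.linear_iff using vector_space_sf_scale by auto
qed

text \<open>A bilinear form is determined by its values on spanning families: products of complete
  functions on the left, monomial functions on the right.\<close>

lemma hall_unique:
  fixes B :: "'a::field_char_0 symfun \<Rightarrow> 'a symfun \<Rightarrow> 'a"
  assumes "bilinear_form B"
    and B: "\<And>lam mu. is_partition lam \<Longrightarrow> is_partition mu \<Longrightarrow>
      B (prod_mset (image_mset h_sym lam)) (m_sym mu) = (if lam = mu then 1 else 0)"
    and "bilinear_form B'"
    and B': "\<And>lam mu. is_partition lam \<Longrightarrow> is_partition mu \<Longrightarrow>
      B' (prod_mset (image_mset h_sym lam)) (m_sym mu) = (if lam = mu then 1 else 0)"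
  shows "B = B'"
proof (intro ext)
  fix f g
  show "B f g = B' f g"
  proof (induction f rule: symfun_h_induct)
    case (h_prod A)
    show ?case
    proof (induction g rule: symfun_m_induct)
      case (monomial A')
      then show ?case using B B' by (simp add: h_prod_def)
    qed (use assms in \<open>auto simp: bilinear_form_iff\<close>)
  qed (use assms in \<open>auto simp: bilinear_form_iff\<close>)
qed

text \<open>By uniqueness the functionals of \<open>pairing\<close> assemble to a bilinear form. It
  has the required duality, since the coefficient of \<open>m_sym mu\<close> at \<open>A\<close>
  tests \<open>exponents A = mu\<close>, so it is the form that \<open>hall\<close>
  describes.\<close>

lemma hall_pairing:
  fixes f :: "'a::field_char_0 symfun"
  shows "pairing f (hall f)"
proof -
  define B :: "'a symfun \<Rightarrow> 'a symfun \<Rightarrow> 'a" where "B f = (THE \<phi>. pairing f \<phi>)" for f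
  have B: "pairing f (B f)" for f
    unfolding B_def by (rule theI'[OF ex_ex1I[OF pairing_exists pairing_unique]])
  have "bilinear_form B"
    unfolding bilinear_form_iff
    using pairing_linear[OF B]
      pairing_unique[OF B pairing.add[OF B B]] pairing_unique[OF B pairing.scale[OF B]] by auto
  moreover have "B (prod_mset (image_mset h_sym lam)) (m_sym mu) = (if lam = mu then 1 else 0)"
    if lam: "is_partition lam" for lam mu
  proof -
    obtain A where A: "exponents A = lam" using exponents_surj[OF lam] by blast
    have "B (h_prod (exponents A)) = (\<lambda>g. sf_coeff g A)"
      by (rule pairing_unique[OF B pairing.h_prod])
    then show ?thesis using A by (simp add: h_prod_def)
  qed
  ultimately have "hall = B"
    unfolding hall_def by (intro the_equality) (blast intro: hall_unique)+
  then show ?thesis using B by simp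
qed

lemma hall_commute: "hall f g = hall (g :: 'a::field_char_0 symfun) f"
  by (rule pairing_commute[OF hall_pairing hall_pairing])

lemma hall_add:
  fixes f g h :: "'a::field_char_0 symfun"
  shows "hall f (g + h) = hall f g + hall f h" "hall (f + g) h = hall f h + hall g h"
  using pairing_linear[OF hall_pairing] by (metis hall_commute)+

lemma hall_scale:
  fixes f g :: "'a::field_char_0 symfun"
  shows "hall f (sf_scale c g) = c * hall f g" "hall (sf_scale c f) g = c * hall f g"
  using pairing_linear[OF hall_pairing] by (metis hall_commute)+

text \<open>The symmetry of \<open>pairing\<close> moves the coefficient extraction to the other
  argument. Nondegeneracy follows, as a function is known from its coefficients.\<close>

lemma hall_h_prod:
  fixes f :: "'a::field_char_0 symfun"
  shows "hall f (h_prod (exponents A)) = sf_coeff f A"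
  using pairing_commute_h_prod[OF hall_pairing] by metis

section \<open>Adjoints\<close>

text \<open>
  The adjoint of multiplication by \<open>h\<^sub>n\<close> takes the coefficient of the \<open>n\<close>-th power of an extra variable.
\<close>

lift_definition extra_coeff :: "nat \<Rightarrow> 'a::comm_ring_1 symfun \<Rightarrow> 'a symfun"
  is "\<lambda>n f A. f (image_mset Suc A + replicate_mset n 0)"
proof safe
  fix n and f :: "monomial \<Rightarrow> 'a" and p A
  assume f: "\<forall>p A. bij p \<longrightarrow> f (image_mset p A) = f A" and p: "bij (p :: nat \<Rightarrow> nat)"
  \<comment> \<open>\<open>q\<close> acts as \<open>p\<close> on the shifted variables and fixes the
    extra variable 0, so invariance of \<open>f\<close> under \<open>q\<close> gives invariance of
    the result under \<open>p\<close>.\<close>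
  define q where "q = case_nat 0 (\<lambda>i. Suc (p i))"
  have inv: "inv p (p i) = i" "p (inv p i) = i" for i
    using p by (simp_all add: bij_is_inj bij_is_surj surj_f_inv_f)
  have "bij q"
  proof (rule o_bij)
    show "case_nat 0 (\<lambda>i. Suc (inv p i)) \<circ> q = id"
      by (auto simp: q_def fun_eq_iff inv split: nat.split)
    show "q \<circ> case_nat 0 (\<lambda>i. Suc (inv p i)) = id"
      by (auto simp: q_def fun_eq_iff inv split: nat.split)
  qed
  moreover have "image_mset q (image_mset Suc A + replicate_mset n 0)
      = image_mset Suc (image_mset p A) + replicate_mset n 0"
    by (simp add: q_def multiset.map_comp comp_def)
  ultimately show "f (image_mset Suc (image_mset p A) + replicate_mset n 0)
      = f (image_mset Suc A + replicate_mset n 0)"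
    using f by metis
qed (metis add_lessD1 not_less_eq size_image_mset size_union trans_less_add1)

lemma exponents_image_Suc: "exponents (image_mset Suc A) = exponents A"
  by (rule exponents_image_mset) simp

text \<open>By symmetry every variable missing from \<open>A\<close> can serve as the extra
  variable.\<close>

lemma sf_coeff_extra_coeff:
  assumes "j \<notin># A"
  shows "sf_coeff (extra_coeff n f) A = sf_coeff f (A + replicate_mset n j)"
proof (cases "n = 0")
  case True
  then show ?thesis using sf_coeff_cong[OF exponents_image_Suc] by (simp add: extra_coeff.rep_eq)
next
  case False
  have "exponents (image_mset Suc A + replicate_mset n 0) = exponents (A + replicate_mset n j)"
    using assms False by (simp add: exponents_add_replicate exponents_image_Suc)
  then show ?thesis unfolding extra_coeff.rep_eq by (rule sf_coeff_cong)
qed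

lemma hall_extra_coeff:
  fixes u v :: "'a::field_char_0 symfun"
  shows "hall (extra_coeff n u) v = hall u (h_sym n * v)"
proof (induction v rule: symfun_h_induct)
  case (h_prod A)
  obtain j where j: "j \<notin># A" by (meson ex_new_if_finite finite_set_mset infinite_UNIV_nat)
  have "h_prod (exponents (A + replicate_mset n j)) = (h_sym n * h_prod (exponents A) :: 'a symfun)"
    using j by (cases "n = 0") (auto simp: exponents_add_replicate h_prod_def h_sym_0)
  then have "hall u (h_sym n * h_prod (exponents A)) = sf_coeff u (A + replicate_mset n j)"
    using hall_h_prod[of u "A + replicate_mset n j"] by simp
  then show ?case by (simp add: hall_h_prod sf_coeff_extra_coeff[OF j])
qed (auto simp: distrib_left hall_add hall_scale times_sf_scale)

text \<open>Composing the operators \<open>extra_coeff\<close> yields adjoints for products of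
  complete functions; linear combinations of adjoints give the rest.\<close>

lemma adjoint_exists:
  fixes g :: "'a::field_char_0 symfun"
  shows "\<exists>T. \<forall>u v. hall (T u) v = hall u (g * v)"
proof (induction g rule: symfun_h_induct)
  case (h_prod A)
  have "\<exists>T. \<forall>u v. hall (T u) v = hall u (h_prod lam * v :: 'a symfun)" for lam
  proof (induction lam)
    case empty
    then show ?case by (intro exI[of _ "\<lambda>u. u"]) (simp add: h_prod_def)
  next
    case (add n lam)
    then obtain T where "\<forall>u v. hall (T u) v = hall u (h_prod lam * v :: 'a symfun)" by blast
    then show ?case
      by (intro exI[of _ "\<lambda>u. T (extra_coeff n u)"]) (simp add: h_prod_def hall_extra_coeff mult.assoc)
  qed
  then show ?case .
next
  case (add g h)
  then obtain S T where "\<forall>u v. hall (S u) v = hall u (g * v)" "\<forall>u v. hall (T u) v = hall u (h * v)"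
    by blast
  then show ?case by (intro exI[of _ "\<lambda>u. S u + T u"]) (simp add: hall_add distrib_right)
next
  case (scale c g)
  then obtain T where "\<forall>u v. hall (T u) v = hall u (g * v)" by blast
  then show ?case by (intro exI[of _ "\<lambda>u. sf_scale c (T u)"]) (simp add: hall_scale sf_scale_times)
qed

lemma hall_eqI:
  fixes f g :: "'a::field_char_0 symfun"
  assumes "\<And>v. hall f v = hall g v"
  shows "f = g"
  by (rule symfun_eqI) (metis assms hall_h_prod)

text \<open>Nondegeneracy makes the adjoint unique, so the description in \<open>perp\<close>
  denotes it.\<close>

lemma hall_perp:
  fixes g u v :: "'a::field_char_0 symfun"
  shows "hall (perp g u) v = hall u (g * v)"
proof -
  have "\<exists>!T. \<forall>u v. hall (T u) v = hall u (g * v)"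
    using adjoint_exists[of g] by (rule ex_ex1I) (auto intro!: hall_eqI)
  from theI'[OF this] show ?thesis unfolding perp_def by blast
qed

section \<open>The adjoints of the elementary functions\<close>

text \<open>In degree \<open>n\<close> the coefficient at \<open>A\<close> is the sum of (-1)^|X|
  over the squarefree divisors of \<open>A\<close>, that is, over the sets X of its variables. This
  is a product of zeros, one for each variable of \<open>A\<close>, and equals 1 only for
  \<open>A = {#}\<close>.\<close>

lemma sum_e_h:
  "(\<Sum>i\<le>n. (- 1) ^ i * (e_sym i * h_sym (n - i)) :: 'a::comm_ring_1 symfun) = (if n = 0 then 1 else 0)"
proof (rule symfun_eqI)
  fix A :: monomial
  let ?sqfree = "\<lambda>B. \<forall>x. count B x \<le> 1"
  let ?S = "{B. B \<subseteq># A \<and> ?sqfree B}"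
  have "sf_coeff (\<Sum>i\<le>n. (- 1) ^ i * (e_sym i * h_sym (n - i)) :: 'a symfun) A
      = (\<Sum>i\<le>n. \<Sum>B | B \<subseteq># A. if size B = i \<and> ?sqfree B \<and> size A = n then (- 1) ^ i else 0)"
    unfolding sf_coeff_sum sf_coeff_minus_one_power
    unfolding sf_coeff_times sum_distrib_left
  proof (intro sum.cong refl)
    fix i B assume "i \<in> {..n}" "B \<in> {B. B \<subseteq># A}"
    then have "size (A - B) = n - i \<longleftrightarrow> size A = n" if "size B = i"
      using that size_mset_mono[of B A] by (auto simp: size_Diff_submset)
    then show "(- 1) ^ i * (sf_coeff (e_sym i) B * sf_coeff (h_sym (n - i)) (A - B))
        = (if size B = i \<and> ?sqfree B \<and> size A = n then (- 1) ^ i else (0 :: 'a))"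
      by (auto simp: e_sym.rep_eq)
  qed
  also have "\<dots> = (\<Sum>B | B \<subseteq># A. \<Sum>i\<le>n. if size B = i \<and> ?sqfree B \<and> size A = n then (- 1) ^ i else 0)"
    by (rule sum.swap)
  also have "\<dots> = (\<Sum>B | B \<subseteq># A. if ?sqfree B then if size A = n then (- 1) ^ size B else 0 else 0)"
  proof (intro sum.cong refl)
    fix B assume "B \<in> {B. B \<subseteq># A}"
    then have "size B \<le> n" if "size A = n" using that size_mset_mono[of B A] by simp
    then show "(\<Sum>i\<le>n. if size B = i \<and> ?sqfree B \<and> size A = n then (- 1) ^ i else 0)
        = (if ?sqfree B then if size A = n then (- 1) ^ size B else 0 else (0 :: 'a))"
    proof (cases "?sqfree B \<and> size A = n")
      case False
      then have "(\<Sum>i\<le>n. if size B = i \<and> ?sqfree B \<and> size A = n then (- 1) ^ i else 0) = (0 :: 'a)"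
        by (intro sum.neutral) auto
      with False show ?thesis by auto
    qed auto
  qed
  also have "\<dots> = (\<Sum>B\<in>?S. if size A = n then (- 1) ^ size B else 0)"
    using sum.inter_filter[OF finite_submsets[of A], of "\<lambda>B. if size A = n then (- 1) ^ size B else (0 :: 'a)" ?sqfree]
    by simp
  also have "\<dots> = (\<Sum>X\<in>Pow (set_mset A). if size A = n then (- 1) ^ card X else 0)"
  proof (rule sum.reindex_bij_witness[of _ mset_set set_mset])
    fix B assume B: "B \<in> ?S"
    show mset: "mset_set (set_mset B) = B"
    proof (rule multiset_eqI)
      fix x
      show "count (mset_set (set_mset B)) x = count B x"
      proof (cases "x \<in># B")
        case True
        have "count B x \<le> 1" using B by blast
        moreover have "count B x \<ge> 1" using True by (simp add: Suc_le_eq)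
        ultimately have "count B x = 1" by linarith
        then show ?thesis using True by simp
      qed (simp add: not_in_iff)
    qed
    show "(if size A = n then (- 1) ^ card (set_mset B) else 0) = (if size A = n then (- 1) ^ size B else (0 :: 'a))"
      by (metis mset size_mset_set)
    show "set_mset B \<in> Pow (set_mset A)" using B set_mset_mono by blast
  next
    fix X assume X: "X \<in> Pow (set_mset A)"
    then have fin: "finite X" by (auto intro: finite_subset)
    then show "set_mset (mset_set X) = X" by simp
    have "count (mset_set X) x \<le> count A x" for x
      using X fin by (cases "x \<in> X") (auto simp: Suc_le_eq)
    then show "mset_set X \<in> ?S"
      using fin by (auto simp: subseteq_mset_def count_mset_set')
  qed
  \<comment> \<open>Expanding the product over all subsets recovers the signed sum.\<close>
  also have "\<dots> = (if size A = n then \<Prod>x\<in>set_mset A. - 1 + 1 else 0)"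
    by (subst prod_add) auto
  also have "\<dots> = sf_coeff (if n = 0 then 1 else 0) A"
    by (cases "A = {#}") (auto simp: power_0_left)
  finally show "sf_coeff (\<Sum>i\<le>n. (- 1) ^ i * (e_sym i * h_sym (n - i)) :: 'a symfun) A
    = sf_coeff (if n = 0 then 1 else 0) A" .
qed

lemma hall_sum:
  fixes f :: "'b \<Rightarrow> 'a::field_char_0 symfun"
  shows "hall (sum f S) g = (\<Sum>x\<in>S. hall (f x) g)" "hall g (sum f S) = (\<Sum>x\<in>S. hall g (f x))"
proof -
  have "hall 0 g = 0" using hall_scale(2)[of 0 0 g] by simp
  then show "hall (sum f S) g = (\<Sum>x\<in>S. hall (f x) g)"
    by (induction S rule: infinite_finite_induct) (auto simp: hall_add)
  then show "hall g (sum f S) = (\<Sum>x\<in>S. hall g (f x))"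
    by (simp add: hall_commute[of g])
qed

lemma minus_one_power_times: "(- 1) ^ n * f = sf_scale ((- 1) ^ n) f"
  by (rule symfun_eqI) simp

text \<open>Adjoint form of \<open>sum_e_h\<close>, with \<open>extra_coeff (n - i)\<close> adjoint
  to multiplication by \<open>h_sym (n - i)\<close>.\<close>

lemma sum_extra_coeff_perp_e:
  fixes f :: "'a::field_char_0 symfun"
  shows "(\<Sum>i\<le>n. (- 1) ^ i * extra_coeff (n - i) (perp (e_sym i) f)) = (if n = 0 then f else 0)"
proof (rule hall_eqI)
  fix v
  have "hall (\<Sum>i\<le>n. (- 1) ^ i * extra_coeff (n - i) (perp (e_sym i) f)) v
      = hall f (\<Sum>i\<le>n. (- 1) ^ i * (e_sym i * h_sym (n - i) * v))"
    by (simp add: hall_sum minus_one_power_times hall_scale hall_extra_coeff hall_perp mult.assoc)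
  also have "(\<Sum>i\<le>n. (- 1) ^ i * (e_sym i * h_sym (n - i) * v))
      = (\<Sum>i\<le>n. (- 1) ^ i * (e_sym i * h_sym (n - i))) * v"
    by (simp add: sum_distrib_right mult.assoc)
  \<comment> \<open>Scaling by zero shows that \<open>hall\<close> vanishes when either argument is
    zero, which settles the case n > 0.\<close>
  also have "hall f \<dots> = hall (if n = 0 then f else 0) v"
    using hall_scale(1)[of f 0 0] hall_scale(2)[of 0 0 v] by (simp add: sum_e_h)
  finally show "hall (\<Sum>i\<le>n. (- 1) ^ i * extra_coeff (n - i) (perp (e_sym i) f)) v
      = hall (if n = 0 then f else 0) v" .
qed

text \<open>The left side is the coefficient of \<open>A\<close> times x_j^n in the sum of all
  (-x_j)^i \<open>perp (e_sym i) f\<close>, and that sum is \<open>f\<close> with x_j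
  deleted.\<close>

lemma sf_coeff_sum_perp_e:
  fixes f :: "'a::field_char_0 symfun"
  assumes "j \<notin># A"
  shows "(\<Sum>i\<le>n. (- 1) ^ i * sf_coeff (perp (e_sym i) f) (A + replicate_mset (n - i) j))
    = (if n = 0 then sf_coeff f A else 0)"
  using arg_cong[OF sum_extra_coeff_perp_e[of n f], of "\<lambda>g. sf_coeff g A"]
  by (simp add: sf_coeff_extra_coeff[OF assms])

text \<open>Solved for its last term, the relation \<open>sf_coeff_sum_perp_e\<close> involves only
  adjoints of \<open>e_sym i\<close> with i < n, at monomials of degree
  \<open>size A + n - i\<close>, so the bound is inherited. This makes the sum in \<open>RM1\<close>
  finite.\<close>

lemma sf_coeff_perp_e_eq_0:
  fixes f :: "'a::field_char_0 symfun"
  assumes d: "\<And>A. size A > d \<Longrightarrow> sf_coeff f A = 0"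
  shows "size A + n > d \<Longrightarrow> sf_coeff (perp (e_sym n) f) A = 0"
proof (induction n arbitrary: A rule: less_induct)
  case (less n)
  obtain j where j: "j \<notin># A" by (meson ex_new_if_finite finite_set_mset infinite_UNIV_nat)
  have "(\<Sum>i<n. (- 1) ^ i * sf_coeff (perp (e_sym i) f) (A + replicate_mset (n - i) j)) = 0"
    by (intro sum.neutral ballI) (use less in simp)
  moreover have "{..n} = insert n {..<n}" by auto
  ultimately have "(- 1) ^ n * sf_coeff (perp (e_sym n) f) A = (if n = 0 then sf_coeff f A else 0)"
    using sf_coeff_sum_perp_e[OF j, where n = n and f = f] by simp
  also have "\<dots> = 0" using d less.prems by simp
  finally show ?case by simp
qed

section \<open>The row-adding operators\<close>

text \<open>After exchanging the sums, the inner sum over \<open>i\<close> for a fixed variable x_j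
  is the deletion sum; it survives only if x_j^a uses up the whole exponent.\<close>

lemma sf_coeff_RM1:
  fixes f :: "'a::field_char_0 symfun"
  assumes "a > 0"
  shows "sf_coeff (RM1 a f) A
    = (\<Sum>j | j \<in># A \<and> count A j = a. sf_coeff f (A - replicate_mset a j))"
proof -
  let ?P = "\<lambda>i. perp (e_sym i) f"
  let ?B = "\<lambda>j. filter_mset (\<lambda>i. i \<noteq> j) A"
  obtain d where d: "\<And>A. size A > d \<Longrightarrow> sf_coeff f A = 0" by (rule sf_coeff_bounded) blast
  \<comment> \<open>Large enough for two purposes: the adjoints vanish beyond \<open>N\<close>, and
    every exponent in \<open>A\<close> is at most \<open>N\<close>, so no inner sum is cut
    short.\<close>
  define N where "N = d + size A"
  have "?P i = 0" if "i > N" for i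
    by (rule symfun_eqI) (use that in \<open>simp add: sf_coeff_perp_e_eq_0[OF d] N_def\<close>)
  then have "RM1 a f = (\<Sum>i\<le>N. (- 1) ^ i * m_sym {#a + i#} * ?P i)"
    unfolding RM1_def by (intro Sum_any.expand_superset) (auto simp: not_less[symmetric])
  then have "sf_coeff (RM1 a f) A
      = (\<Sum>i\<le>N. (- 1) ^ i * (\<Sum>j | j \<in># A \<and> a + i \<le> count A j.
          sf_coeff (?P i) (A - replicate_mset (a + i) j)))"
    using assms by (simp add: mult.assoc sf_coeff_power_sum_times)
  also have "\<dots> = (\<Sum>i\<le>N. \<Sum>j\<in>set_mset A. if a + i \<le> count A j
      then (- 1) ^ i * sf_coeff (?P i) (A - replicate_mset (a + i) j) else 0)"
    by (auto simp: sum_distrib_left sum.inter_filter intro!: sum.cong)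
  also have "\<dots> = (\<Sum>j\<in>set_mset A. \<Sum>i\<le>N. if a + i \<le> count A j
      then (- 1) ^ i * sf_coeff (?P i) (A - replicate_mset (a + i) j) else 0)"
    by (rule sum.swap)
  also have "\<dots> = (\<Sum>j\<in>set_mset A. if count A j = a then sf_coeff f (A - replicate_mset a j) else 0)"
  proof (intro sum.cong refl)
    fix j assume "j \<in># A"
    show "(\<Sum>i\<le>N. if a + i \<le> count A j
          then (- 1) ^ i * sf_coeff (?P i) (A - replicate_mset (a + i) j) else 0)
        = (if count A j = a then sf_coeff f (A - replicate_mset a j) else 0)"
    proof (cases "a \<le> count A j")
      case True
      \<comment> \<open>The exponent of x_j left over once x_j^a is removed.\<close>
      define n where "n = count A j - a"
      have "n \<le> N" using count_le_size[of A j] by (simp add: n_def N_def)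
      then have "{i \<in> {..N}. a + i \<le> count A j} = {..n}" using True by (auto simp: n_def)
      then have "(\<Sum>i\<le>N. if a + i \<le> count A j
            then (- 1) ^ i * sf_coeff (?P i) (A - replicate_mset (a + i) j) else 0)
          = (\<Sum>i\<le>n. (- 1) ^ i * sf_coeff (?P i) (A - replicate_mset (a + i) j))"
        by (simp flip: sum.inter_filter)
      also have "\<dots> = (\<Sum>i\<le>n. (- 1) ^ i * sf_coeff (?P i) (?B j + replicate_mset (n - i) j))"
      proof (intro sum.cong refl)
        fix i assume "i \<in> {..n}"
        have "A - replicate_mset (a + i) j = ?B j + replicate_mset (n - i) j"
          by (rule multiset_eqI) (simp add: n_def)
        then show "(- 1) ^ i * sf_coeff (?P i) (A - replicate_mset (a + i) j)
            = (- 1) ^ i * sf_coeff (?P i) (?B j + replicate_mset (n - i) j)" by simp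
      qed
      also have "\<dots> = (if n = 0 then sf_coeff f (?B j) else 0)"
        by (rule sf_coeff_sum_perp_e) simp
      also have "\<dots> = (if count A j = a then sf_coeff f (A - replicate_mset a j) else 0)"
      proof -
        have "?B j = A - replicate_mset a j" if "count A j = a"
          by (rule multiset_eqI) (use that in simp)
        then show ?thesis using True by (auto simp: n_def)
      qed
      finally show ?thesis .
    qed auto
  qed
  also have "\<dots> = (\<Sum>j | j \<in># A \<and> count A j = a. sf_coeff f (A - replicate_mset a j))"
    by (simp add: sum.inter_filter)
  finally show ?thesis .
qed

section \<open>Action on monomial functions\<close>

lemma RM1_scale:
  "a > 0 \<Longrightarrow> RM1 a (sf_scale c f) = sf_scale c (RM1 a (f :: 'a::field_char_0 symfun))"
  by (rule symfun_eqI) (simp add: sf_coeff_RM1 sum_distrib_left)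

lemma RM1_power_zero: "a > 0 \<Longrightarrow> (RM1 a ^^ n) 0 = (0 :: 'a::field_char_0 symfun)"
proof (induction n)
  case (Suc n)
  then have "RM1 a 0 = (0 :: 'a symfun)" by (intro symfun_eqI) (simp add: sf_coeff_RM1)
  with Suc show ?case by simp
qed simp

text \<open>Each monomial of \<open>m_sym (add_mset a lam)\<close> arises once from every variable
  of exponent \<open>a\<close> in it, and there are \<open>count lam a + 1\<close> of them.\<close>

lemma RM1_m_sym:
  assumes "a > 0"
  shows "RM1 a (m_sym lam :: 'a::field_char_0 symfun)
    = sf_scale (of_nat (count lam a + 1)) (m_sym (add_mset a lam))"
proof (rule symfun_eqI)
  fix A
  show "sf_coeff (RM1 a (m_sym lam :: 'a symfun)) A
    = sf_coeff (sf_scale (of_nat (count lam a + 1)) (m_sym (add_mset a lam))) A"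
    unfolding sf_coeff_RM1[OF assms] m_sym.rep_eq sum_exponents_minus_replicate[OF assms] by simp
qed

lemma sf_scale_scale: "sf_scale c (sf_scale d f) = sf_scale (c * d) f"
  by (rule symfun_eqI) (simp add: mult.assoc)

text \<open>The multiplicity of \<open>a\<close> grows by one with each application, so the factors
  are consecutive integers and form a quotient of factorials.\<close>

lemma RM1_power_m_sym:
  assumes "a > 0"
  shows "(RM1 a ^^ n) (m_sym lam :: 'a::field_char_0 symfun)
    = sf_scale (fact (count lam a + n) / fact (count lam a)) (m_sym (lam + replicate_mset n a))"
proof (induction n)
  case 0
  show ?case by (rule symfun_eqI) simp
next
  case (Suc n)
  then show ?case
    by (simp add: RM1_scale RM1_m_sym assms sf_scale_scale algebra_simps)
qed

text \<open>The coefficient at \<open>A\<close> is the Hall product of \<open>m_sym lam\<close> with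
  the complete product for \<open>exponents A\<close> enlarged by \<open>k\<close> parts
  \<open>a\<close>; duality then compares the two partitions.\<close>

lemma perp_h_power_m_sym:
  assumes "a > 0"
  shows "perp (h_sym a ^ k) (m_sym lam :: 'a::field_char_0 symfun)
    = (if k \<le> count lam a then m_sym (lam - replicate_mset k a) else 0)"
proof (rule symfun_eqI)
  fix A
  have "h_sym a ^ k = (h_prod (replicate_mset k a) :: 'a symfun)" by (simp add: h_prod_def)
  then have "sf_coeff (perp (h_sym a ^ k) (m_sym lam :: 'a symfun)) A
      = hall (m_sym lam) (h_prod (exponents A + replicate_mset k a))"
    by (simp add: hall_h_prod[symmetric] hall_perp) (simp add: h_prod_def mult.commute)
  moreover have "is_partition (exponents A + replicate_mset k a)"
    using is_partition_exponents[of A] assms by (auto simp: is_partition_def)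
  \<comment> \<open>\<open>hall_h_prod\<close> speaks of monomials, so one with these exponents is
    chosen; \<open>a > 0\<close> keeps the multiset a partition.\<close>
  then obtain B where B: "exponents B = exponents A + replicate_mset k a" by (rule exponents_surj)
  ultimately have "sf_coeff (perp (h_sym a ^ k) (m_sym lam :: 'a symfun)) A
      = (if exponents A + replicate_mset k a = lam then 1 else 0)"
    using hall_h_prod[of "m_sym lam :: 'a symfun" B] by simp
  also have "exponents A + replicate_mset k a = lam
      \<longleftrightarrow> k \<le> count lam a \<and> exponents A = lam - replicate_mset k a"
    by (auto simp: count_le_replicate_mset_subset_eq)
  finally show "sf_coeff (perp (h_sym a ^ k) (m_sym lam :: 'a symfun)) A
      = sf_coeff (if k \<le> count lam a then m_sym (lam - replicate_mset k a) else 0) A"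
    by simp
qed

text \<open>The full alternating sum over row \<open>n + 1\<close> is zero; beyond its first term 1
  it is, after an index shift, the negative of this sum.\<close>

lemma sum_alternating_choose_Suc:
  "(\<Sum>k\<le>n. (- 1) ^ k * of_nat (Suc n choose Suc k)) = (1 :: 'a::comm_ring_1)"
proof -
  have "(\<Sum>i\<le>Suc n. (- 1) ^ i * of_nat (Suc n choose i)) = (0 :: 'a)"
    by (rule choose_alternating_sum) simp
  then show ?thesis
    unfolding sum.atMost_Suc_shift by (simp add: sum_negf del: binomial_Suc_Suc)
qed

theorem mainTheorem8:
  fixes a :: nat and lam :: "partition"
  assumes "a > 0" and "is_partition lam"
  shows "RM a (m_sym lam :: 'a::field_char_0 symfun) = m_sym (add_mset a lam)"
proof -
  define n where "n = count lam a"
  let ?m = "m_sym (add_mset a lam) :: 'a symfun"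
  let ?term = "\<lambda>k. sf_scale ((-1) ^ k / fact (k + 1))
     ((RM1 a ^^ (k + 1)) (perp (h_sym a ^ k) (m_sym lam :: 'a symfun)))"
  \<comment> \<open>Removing \<open>k\<close> copies of \<open>a\<close> leaves
    \<open>n - k\<close>; adding \<open>k + 1\<close> copies then gives the factor (n + 1)! / (n -
    k)! and one copy more than at the start. Division by (k + 1)! leaves a binomial
    coefficient.\<close>
  have small: "?term k = sf_scale ((- 1) ^ k * of_nat (Suc n choose Suc k)) ?m" if "k \<le> n" for k
  proof -
    have le: "k \<le> count lam a" using that by (simp add: n_def)
    then have "lam - replicate_mset k a + replicate_mset (k + 1) a = add_mset a lam"
      by (intro multiset_eqI) (use le in auto)
    then have "(RM1 a ^^ (k + 1)) (perp (h_sym a ^ k) (m_sym lam :: 'a symfun))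
        = sf_scale (fact (Suc n) / fact (n - k)) ?m"
      unfolding perp_h_power_m_sym[OF assms(1)] if_P[OF le] RM1_power_m_sym[OF assms(1)]
      using that by (simp add: n_def)
    moreover have "(- 1) ^ k / fact (k + 1) * (fact (Suc n) / fact (n - k))
        = ((- 1) ^ k * of_nat (Suc n choose Suc k) :: 'a)"
      using that binomial_fact[of "Suc k" "Suc n", where ?'a = 'a]
      by (simp del: fact_Suc binomial_Suc_Suc)
    ultimately show ?thesis by (simp only: sf_scale_scale)
  qed
  have large: "?term k = 0" if "k > n" for k
  proof -
    have "perp (h_sym a ^ k) (m_sym lam) = (0 :: 'a symfun)"
      using that by (simp add: perp_h_power_m_sym[OF assms(1)] n_def)
    moreover have "sf_scale c 0 = (0 :: 'a symfun)" for c by (rule symfun_eqI) simp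
    ultimately show ?thesis by (simp only: RM1_power_zero[OF assms(1)])
  qed
  have "RM a (m_sym lam :: 'a symfun) = (\<Sum>k\<le>n. ?term k)"
    unfolding RM_def
  proof (rule Sum_any.expand_superset)
    show "{k. ?term k \<noteq> 0} \<subseteq> {..n}" using large not_le_imp_less by blast
  qed simp
  also have "\<dots> = (\<Sum>k\<le>n. sf_scale ((- 1) ^ k * of_nat (Suc n choose Suc k)) ?m)"
    by (intro sum.cong refl small) simp
  also have "\<dots> = ?m"
  proof (rule symfun_eqI)
    fix A
    have "sf_coeff (\<Sum>k\<le>n. sf_scale ((- 1) ^ k * of_nat (Suc n choose Suc k)) ?m) A
        = (\<Sum>k\<le>n. (- 1) ^ k * of_nat (Suc n choose Suc k)) * sf_coeff ?m A"
      by (simp only: sf_coeff_sum sf_scale.rep_eq sum_distrib_right)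
    then show "sf_coeff (\<Sum>k\<le>n. sf_scale ((- 1) ^ k * of_nat (Suc n choose Suc k)) ?m) A = sf_coeff ?m A"
      by (simp only: sum_alternating_choose_Suc mult_1)
  qed
  finally show ?thesis .
qed

end
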